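(* Let $K\subset\mathbb R^n$ be a convex body containing the origin in its interior, and suppose that $\lambda$ and $\lambda(K,\cdot)$ are Borel measures on $S^{n-1}$. Then $\lambda(K,\cdot)$ is weakly Aleksandrov related to $\lambda$.
   Context: A convex body is a compact convex subset of $\mathbb R^n$ with nonempty interior. For a convex body $K$ containing the origin in its interior: $\rho_K(u)=\max\{a:au\in K\}$ and $r_K(u)=\rho_K(u)u\in\partial K$ for $u\in S^{n-1}$; for $x\in\partial K$ the normal cone is $N(K,x)=\{v\in S^{n-1}:(y-x)\cdot v\le0\text{ for all }y\in K\}$; the radial Gauss image of $\omega\subset S^{n-1}$ is $\boldsymbol\alpha_K(\omega)=\bigcup_{u\in\omega}N(K,r_K(u))$. It maps Borel sets to Lebesgue measurable sets. For Borel $\omega\subset S^{n-1}$, $\lambda(K,\omega):=\lambda(\boldsymbol\alpha_K(\omega))$ (here $\lambda$ is understood to be defined on Lebesgue measurable subsets of $S^{n-1}$, so that this makes sense). In general the set function $\lambda(K,\cdot)$ need not be a measure; here it is assumed to be one. For a closed set $\omega\subset S^{n-1}$ and $\beta\in(0,\frac\pi2]$, $\omega_\beta=\bigcup_{u\in\omega}\{v\in S^{n-1}:u\cdot v>\cos\beta\}$. Weak Aleksandrov relation: a Borel measure $\mu$ on $S^{n-1}$ is weakly Aleksandrov related to a Borel measure $\lambda$ on $S^{n-1}$ if $\mu(S^{n-1})=\lambda(S^{n-1})$ and for each closed set $\omega\subset S^{n-1}$ contained in a closed hemisphere there exists $\alpha\in(0,\frac\pi2)$ such that $\mu(\omega)\le\lambda(\omega_{\frac\pi2-\alpha})$.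 *)

theory Defs
  imports "HOL-Probability.Conditional_Expectation"
begin

abbreviation unit_sphere :: "'a::euclidean_space set"
  where "unit_sphere \<equiv> sphere 0 1"

definition convex_body :: "'a::euclidean_space set \<Rightarrow> bool"
  where "convex_body K \<longleftrightarrow> compact K \<and> convex K \<and> interior K \<noteq> {}"

definition radial_function :: "'a::euclidean_space set \<Rightarrow> 'a \<Rightarrow> real"
  where "radial_function K u = (GREATEST a. a *\<^sub>R u \<in> K)"

definition radial_map :: "'a::euclidean_space set \<Rightarrow> 'a \<Rightarrow> 'a"
  where "radial_map K u = radial_function K u *\<^sub>R u"

definition normal_cone :: "'a::euclidean_space set \<Rightarrow> 'a \<Rightarrow> 'a set"
  where "normal_cone K x = {v \<in> unit_sphere. \<forall>y\<in>K. (y - x) \<bullet> v \<le> 0}"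

definition radial_Gauss_image :: "'a::euclidean_space set \<Rightarrow> 'a set \<Rightarrow> 'a set"
  where "radial_Gauss_image K \<omega> = (\<Union>u\<in>\<omega>. normal_cone K (radial_map K u))"

definition sphere_borel :: "'a::euclidean_space measure"
  where "sphere_borel = restrict_space borel unit_sphere"

text \<open>Spherical Lebesgue measure: a Borel set \<open>A\<close> of directions gets \<open>n\<close> times the volume of
  the part of the unit ball lying over \<open>A\<close> (\<open>sgn x\<close> is \<open>x\<close> divided by its norm), and the result
  is completed. The sets of this measure are the Lebesgue measurable subsets of the sphere.\<close>

definition sphere_lebesgue :: "'a::euclidean_space measure"
  where "sphere_lebesgue =
    completion (scale_measure (of_nat DIM('a))
      (distr (restrict_space lborel (ball 0 1 - {0})) sphere_borel sgn))"

definition gauss_image_function :: "'a::euclidean_space measure \<Rightarrow> 'a set \<Rightarrow> 'a set \<Rightarrow> ennreal"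
  where "gauss_image_function lam K \<omega> = emeasure lam (radial_Gauss_image K \<omega>)"

definition gauss_image_is_measure :: "'a::euclidean_space measure \<Rightarrow> 'a set \<Rightarrow> bool"
  where "gauss_image_is_measure lam K \<longleftrightarrow>
    measure_space unit_sphere (sets sphere_borel) (gauss_image_function lam K)"

text \<open>The set function above packaged as a measure on the Borel sets. Under
  \<open>gauss_image_is_measure\<close> the two agree on Borel sets; otherwise \<open>measure_of\<close> yields the zero
  measure.\<close>

definition gauss_image_measure :: "'a::euclidean_space measure \<Rightarrow> 'a set \<Rightarrow> 'a measure"
  where "gauss_image_measure lam K =
    measure_of unit_sphere (sets sphere_borel) (gauss_image_function lam K)"

definition in_closed_hemisphere :: "'a::euclidean_space set \<Rightarrow> bool"
  where "in_closed_hemisphere \<omega> \<longleftrightarrow>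
    (\<exists>e\<in>unit_sphere. \<omega> \<subseteq> {v \<in> unit_sphere. 0 \<le> e \<bullet> v})"

definition outer_parallel :: "'a::euclidean_space set \<Rightarrow> real \<Rightarrow> 'a set"
  where "outer_parallel \<omega> \<beta> = (\<Union>u\<in>\<omega>. {v \<in> unit_sphere. u \<bullet> v > cos \<beta>})"

definition weakly_Aleksandrov_related ::
    "'a::euclidean_space measure \<Rightarrow> 'a measure \<Rightarrow> bool"
  where "weakly_Aleksandrov_related \<mu> \<nu> \<longleftrightarrow>
    sets \<mu> = sets sphere_borel \<and> sets \<nu> = sets sphere_borel \<and>
    emeasure \<mu> unit_sphere = emeasure \<nu> unit_sphere \<and>
    (\<forall>\<omega>. closed \<omega> \<and> \<omega> \<subseteq> unit_sphere \<and> in_closed_hemisphere \<omega> \<longrightarrow>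
      (\<exists>\<alpha>. 0 < \<alpha> \<and> \<alpha> < pi / 2 \<and> emeasure \<mu> \<omega> \<le> emeasure \<nu> (outer_parallel \<omega> (pi / 2 - \<alpha>))))"

end

theory Submission
  imports Defs
begin

text \<open>The body lies between two balls \<open>cball 0 r \<subseteq> K \<subseteq> cball 0 R\<close>. If \<open>v\<close> is an outer normal
  of \<open>K\<close> at \<open>x = \<rho>\<^sub>K(u) u\<close>, then \<open>x \<bullet> v\<close> is the maximum of \<open>y \<bullet> v\<close> over \<open>y \<in> K\<close>, hence at least
  \<open>r\<close>, while \<open>\<rho>\<^sub>K(u) \<le> R\<close>; so \<open>u \<bullet> v \<ge> r / R\<close>. The angle between a direction and a normal at
  the corresponding boundary point therefore stays below \<open>\<pi>/2\<close> by an amount \<open>\<alpha>\<close> depending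
  on \<open>K\<close> alone, which puts \<open>\<^bold>\<alpha>\<^sub>K(\<omega>)\<close> inside \<open>\<omega>\<close> enlarged by the angle \<open>\<pi>/2 - \<alpha>\<close>
  (\<open>radial_Gauss_image_subset_outer_parallel\<close>). Monotonicity of the measure gives the inequality,
  the enlarged set being relatively open in the sphere and thus Borel.

  The total masses agree because every direction \<open>v\<close> is an outer normal somewhere: the linear
  functional \<open>y \<bullet> v\<close> attains its maximum on the compact set \<open>K\<close>, and the maximizer is the
  boundary point in its own direction (\<open>radial_Gauss_image_unit_sphere\<close>).\<close>

lemma radial_map_mem:
  assumes "compact K" "0 \<in> K" "norm u = 1"
  shows "radial_map K u \<in> K" "0 \<le> radial_function K u"
proof -
  let ?A = "{a::real. a *\<^sub>R u \<in> K}"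
  have "closed ((\<lambda>a::real. a *\<^sub>R u) -` K)"
    using assms(1) by (intro continuous_closed_vimage compact_imp_closed) auto
  then have "closed ?A"
    by (simp add: vimage_def)
  moreover have "bounded ?A"
  proof -
    obtain B where B: "\<And>x. x \<in> K \<Longrightarrow> norm x \<le> B"
      using compact_imp_bounded[OF assms(1)] unfolding bounded_iff by blast
    have "norm a \<le> B" if "a \<in> ?A" for a
      using B[of "a *\<^sub>R u"] that assms(3) by simp
    then show ?thesis
      unfolding bounded_iff by blast
  qed
  ultimately have "compact ?A"
    by (simp add: compact_eq_bounded_closed)
  moreover have "0 \<in> ?A"
    using assms(2) by simp
  ultimately obtain s where s: "s \<in> ?A" "\<And>t. t \<in> ?A \<Longrightarrow> t \<le> s"
    using compact_attains_sup[of ?A] by blast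
  then have "radial_function K u = s"
    unfolding radial_function_def by (intro Greatest_equality) auto
  with s \<open>0 \<in> ?A\<close> show "radial_map K u \<in> K" "0 \<le> radial_function K u"
    unfolding radial_map_def by auto
qed

text \<open>This is the quantitative core: the constant is essentially the ratio of an inner to an
  outer radius of \<open>K\<close>.\<close>

lemma normal_cone_uniformly_acute:
  assumes "compact K" "0 \<in> interior K"
  obtains c where "0 < c" "c < 1"
    "\<And>u v. u \<in> unit_sphere \<Longrightarrow> v \<in> normal_cone K (radial_map K u) \<Longrightarrow> c < u \<bullet> v"
proof -
  obtain r where r: "r > 0" "cball 0 r \<subseteq> K"
    using assms(2) unfolding mem_interior_cball by blast
  obtain R where R: "R > 0" "\<And>x. x \<in> K \<Longrightarrow> norm x \<le> R"
    using compact_imp_bounded[OF assms(1)] unfolding bounded_pos by blast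
  have K0: "0 \<in> K"
    using assms(2) interior_subset by blast
  \<comment> \<open>Adding \<open>r\<close> to the denominator makes the constant less than both \<open>1\<close> and \<open>r / R\<close>.\<close>
  show thesis
  proof (rule that[of "r / (R + r)"])
    show "0 < r / (R + r)" "r / (R + r) < 1"
      using r R by auto
  next
    fix u v :: 'a
    assume u: "u \<in> unit_sphere" and v: "v \<in> normal_cone K (radial_map K u)"
    let ?\<rho> = "radial_function K u"
    have nu: "norm u = 1" and nv: "norm v = 1"
      using u v unfolding normal_cone_def by auto
    have mem: "radial_map K u \<in> K" and \<rho>0: "0 \<le> ?\<rho>"
      using radial_map_mem[OF assms(1) K0 nu] by auto
    have \<rho>R: "?\<rho> \<le> R"
      using R(2)[OF mem] \<rho>0 nu by (simp add: radial_map_def)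
    have "r *\<^sub>R v \<in> K"
      using r nv by (auto intro!: subsetD[OF r(2)])
    then have "(r *\<^sub>R v - radial_map K u) \<bullet> v \<le> 0"
      using v unfolding normal_cone_def by blast
    then have le: "r \<le> ?\<rho> * (u \<bullet> v)"
      using nv by (simp add: radial_map_def inner_diff_left dot_square_norm)
    have "0 < ?\<rho> * (u \<bullet> v)"
      using le r(1) by linarith
    then have pos: "0 < u \<bullet> v"
      using \<rho>0 by (simp add: zero_less_mult_iff)
    have "?\<rho> * (u \<bullet> v) \<le> R * (u \<bullet> v)"
      using \<rho>R pos by (intro mult_right_mono) auto
    also have "\<dots> < (R + r) * (u \<bullet> v)"
      using r(1) pos by simp
    finally have "r < (R + r) * (u \<bullet> v)"
      using le by linarith
    then show "r / (R + r) < u \<bullet> v"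
      using r(1) R(1) by (simp add: pos_divide_less_eq mult.commute)
  qed
qed

text \<open>With \<open>\<alpha> = arcsin c\<close> the bound \<open>u \<bullet> v > c\<close> of the previous lemma reads
  \<open>u \<bullet> v > cos (\<pi>/2 - \<alpha>)\<close>.\<close>

lemma radial_Gauss_image_subset_outer_parallel:
  assumes "compact K" "0 \<in> interior K"
  obtains \<alpha> where "0 < \<alpha>" "\<alpha> < pi / 2"
    "\<And>\<omega>. \<omega> \<subseteq> unit_sphere \<Longrightarrow> radial_Gauss_image K \<omega> \<subseteq> outer_parallel \<omega> (pi / 2 - \<alpha>)"
proof -
  obtain c where c: "0 < c" "c < 1"
    "\<And>u v. u \<in> unit_sphere \<Longrightarrow> v \<in> normal_cone K (radial_map K u) \<Longrightarrow> c < u \<bullet> v"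
    using normal_cone_uniformly_acute[OF assms] by blast
  show thesis
  proof (rule that[of "arcsin c"])
    show "0 < arcsin c"
      using c arcsin_less_arcsin[of 0 c] by simp
    show "arcsin c < pi / 2"
      using c arcsin_lt_bounded[of c] by simp
    have cos_eq: "cos (pi / 2 - arcsin c) = c"
      using c(1,2) by (simp add: cos_diff)
    have "normal_cone K (radial_map K u) \<subseteq> {v \<in> unit_sphere. c < u \<bullet> v}"
      if "u \<in> unit_sphere" for u
      using c(3)[OF that] unfolding normal_cone_def by blast
    then show "radial_Gauss_image K \<omega> \<subseteq> outer_parallel \<omega> (pi / 2 - arcsin c)"
      if "\<omega> \<subseteq> unit_sphere" for \<omega>
      using that unfolding radial_Gauss_image_def outer_parallel_def cos_eq by blast
  qed
qed

lemma radial_Gauss_image_unit_sphere: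
  assumes "compact K" "0 \<in> interior K"
  shows "radial_Gauss_image K unit_sphere = unit_sphere"
proof
  show "radial_Gauss_image K unit_sphere \<subseteq> unit_sphere"
    unfolding radial_Gauss_image_def normal_cone_def by blast
  show "unit_sphere \<subseteq> radial_Gauss_image K unit_sphere"
  proof
    fix v :: 'a
    assume "v \<in> unit_sphere"
    then have nv: "norm v = 1" by simp
    obtain r where r: "r > 0" "cball 0 r \<subseteq> K"
      using assms(2) unfolding mem_interior_cball by blast
    have rv: "r *\<^sub>R v \<in> K"
      using r nv by (auto intro!: subsetD[OF r(2)])
    have "continuous_on K (\<lambda>y. y \<bullet> v)"
      by (intro continuous_intros)
    then obtain x where x: "x \<in> K" "\<And>y. y \<in> K \<Longrightarrow> y \<bullet> v \<le> x \<bullet> v"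
      using continuous_attains_sup[of K "\<lambda>y. y \<bullet> v"] assms(1) rv by blast
    have xv: "0 < x \<bullet> v"
      using x(2)[OF rv] r(1) nv by (simp add: dot_square_norm)
    then have "x \<noteq> 0" by auto
    then have nx: "0 < norm x" by simp
    have xs: "x = norm x *\<^sub>R sgn x"
      using \<open>x \<noteq> 0\<close> by (simp add: sgn_div_norm)
    then have "x \<bullet> v = norm x * (sgn x \<bullet> v)"
      using inner_scaleR_left[of "norm x" "sgn x" v] by simp
    then have sv: "0 < sgn x \<bullet> v"
      using xv nx by (simp add: zero_less_mult_iff)
    \<comment> \<open>A point of \<open>K\<close> further out on the ray through \<open>x\<close> would have a larger product with \<open>v\<close>.\<close>
    have "radial_function K (sgn x) = norm x"
      unfolding radial_function_def
    proof (rule Greatest_equality)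
      show "norm x *\<^sub>R sgn x \<in> K"
        using xs x(1) by simp
      fix a assume "a *\<^sub>R sgn x \<in> K"
      from x(2)[OF this] have "a * (sgn x \<bullet> v) \<le> norm x * (sgn x \<bullet> v)"
        unfolding \<open>x \<bullet> v = norm x * (sgn x \<bullet> v)\<close> by (simp only: inner_scaleR_left)
      then show "a \<le> norm x"
        using sv by simp
    qed
    then have "radial_map K (sgn x) = x"
      using xs unfolding radial_map_def by simp
    then have "v \<in> normal_cone K (radial_map K (sgn x))"
      using nv x(2) unfolding normal_cone_def by (simp add: inner_diff_left)
    moreover have "sgn x \<in> unit_sphere"
      using \<open>x \<noteq> 0\<close> by (simp add: norm_sgn)
    ultimately show "v \<in> radial_Gauss_image K unit_sphere"
      unfolding radial_Gauss_image_def by blast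
  qed
qed

lemma space_sphere_borel: "space sphere_borel = unit_sphere"
  by (simp add: sphere_borel_def space_restrict_space)

lemma subalgebra_sphere_borel:
  assumes "sets lam = sets sphere_lebesgue"
  shows "subalgebra lam sphere_borel"
proof -
  have "space lam = unit_sphere"
    using sets_eq_imp_space_eq[OF assms] by (simp add: sphere_lebesgue_def space_scale_measure space_sphere_borel)
  then show ?thesis
    unfolding subalgebra_def assms
    by (auto simp: sphere_lebesgue_def space_sphere_borel intro: sets_completionI_sets)
qed

lemma emeasure_gauss_image_measure:
  assumes "gauss_image_is_measure lam K" "\<omega> \<in> sets sphere_borel"
  shows "emeasure (gauss_image_measure lam K) \<omega> = emeasure lam (radial_Gauss_image K \<omega>)"
proof -
  have "emeasure (gauss_image_measure lam K) \<omega> = gauss_image_function lam K \<omega>"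
    using assms unfolding gauss_image_measure_def gauss_image_is_measure_def measure_space_def
    by (intro emeasure_measure_of_sigma) auto
  then show ?thesis
    by (simp add: gauss_image_function_def)
qed

lemma sets_gauss_image_measure: "sets (gauss_image_measure lam K) = sets sphere_borel"
  using sets.sets_measure_of_eq[of sphere_borel]
  by (simp add: gauss_image_measure_def space_sphere_borel)

lemma outer_parallel_in_sphere_borel: "outer_parallel \<omega> \<beta> \<in> sets sphere_borel"
proof -
  have "open {v. u \<bullet> v > cos \<beta>}" for u :: 'a
    by (intro open_Collect_less continuous_intros)
  then have "open (\<Union>u\<in>\<omega>. {v. u \<bullet> v > cos \<beta>})"
    by (intro open_UN) simp
  moreover have "outer_parallel \<omega> \<beta> = unit_sphere \<inter> (\<Union>u\<in>\<omega>. {v. u \<bullet> v > cos \<beta>})"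
    unfolding outer_parallel_def by blast
  ultimately show ?thesis
    unfolding sphere_borel_def sets_restrict_space by (intro image_eqI) auto
qed

theorem proposition3p1:
  fixes K :: "(real ^ 'n) set" and lam :: "(real ^ 'n) measure"
  assumes "convex_body K" and "0 \<in> interior K"
    and "sets lam = sets sphere_lebesgue"
    and "gauss_image_is_measure lam K"
  shows "weakly_Aleksandrov_related (gauss_image_measure lam K) (restr_to_subalg lam sphere_borel)"
proof -
  have K: "compact K"
    using assms(1) unfolding convex_body_def by blast
  note sub = subalgebra_sphere_borel[OF assms(3)]
  note mu = emeasure_gauss_image_measure[OF assms(4)]
  note nu = emeasure_restr_to_subalg[OF sub]
  have sphere: "unit_sphere \<in> sets (sphere_borel :: (real ^ 'n) measure)"
    using sets.top[of sphere_borel] unfolding space_sphere_borel .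
  have total: "emeasure (gauss_image_measure lam K) unit_sphere
      = emeasure (restr_to_subalg lam sphere_borel) unit_sphere"
    using radial_Gauss_image_unit_sphere[OF K assms(2)] by (simp add: mu[OF sphere] nu[OF sphere])
  obtain \<alpha> where \<alpha>: "0 < \<alpha>" "\<alpha> < pi / 2"
    "\<And>\<omega>. \<omega> \<subseteq> unit_sphere \<Longrightarrow> radial_Gauss_image K \<omega> \<subseteq> outer_parallel \<omega> (pi / 2 - \<alpha>)"
    using radial_Gauss_image_subset_outer_parallel[OF K assms(2)] by blast
  have le: "emeasure (gauss_image_measure lam K) \<omega>
      \<le> emeasure (restr_to_subalg lam sphere_borel) (outer_parallel \<omega> (pi / 2 - \<alpha>))"
    if "closed \<omega>" "\<omega> \<subseteq> unit_sphere" for \<omega>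
  proof -
    let ?P = "outer_parallel \<omega> (pi / 2 - \<alpha>)"
    have "\<omega> \<in> sets sphere_borel"
      using that unfolding sphere_borel_def by (auto simp: sets_restrict_space_iff)
    moreover have P: "?P \<in> sets sphere_borel"
      by (rule outer_parallel_in_sphere_borel)
    moreover have "?P \<in> sets lam"
      using P sub unfolding subalgebra_def by blast
    ultimately show ?thesis
      using \<alpha>(3)[OF that(2)] by (simp add: mu nu emeasure_mono)
  qed
  show ?thesis
    unfolding weakly_Aleksandrov_related_def
    using total le \<alpha>(1,2) sets_gauss_image_measure sets_restr_to_subalg[OF sub] by blast
qed

end
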